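(* Let $X_n$ be the number of correct guesses under the optimal strategy for an $n$-card deck riffle-shuffled once. Then the skewness coefficient $$\frac{E[(X_n-E[X_n])^3]}{\left(E[(X_n-E[X_n])^2]\right)^{3/2}}$$ does not tend to $0$ as $n\to\infty$, and $X_n$ is not asymptotically normally distributed; that is, $(X_n-E[X_n])/\sqrt{\operatorname{Var}(X_n)}$ does not converge in distribution to the standard normal distribution as $n\to\infty$.
   Context: Riffle shuffle (Gilbert–Shannon–Reeds model): a deck of $n$ cards labeled $1,\dots,n$ from top to bottom is cut so that the top pile consists of the top $t$ cards with probability $\binom{n}{t}/2^n$ ($0\le t\le n$); then the two piles are interleaved into a single deck, keeping the relative order inside each pile, all $\binom nt$ interleavings being equally likely. Thus each pair (cut position, interleaving) has probability $2^{-n}$. Game with complete feedback: after one riffle shuffle the player guesses the cards one at a time from the top; after each guess the identity of that card is revealed. The goal is to maximize the expected number of correct guesses. Optimal strategy for one shuffle: as long as the revealed cards are $1,2,\dots,j$ (with $j\ge 0$), guess $j+1$. At the first time the revealed card is some $m\neq j+1$, the remaining deck is known to be an interleaving of the two increasing sequences $\{j+1,\dots,m-1\}$ and $\{m+1,\dots,n\}$; from then on, always guess the first (smallest) remaining card of the longer of the two remaining sequences (in case of equal lengths, the one giving the lower card number). $X_n$ is the total number of correct guesses under this strategy for a deck of $n$ cards shuffled once. *)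

theory Defs
  imports "HOL-Probability.Probability"
begin

text \<open>A deck is the list of its cards from top to bottom.  The cut position is binomially
  distributed with parameters \<open>n\<close> and \<open>1/2\<close>; given the cut, the two piles are interleaved
  uniformly at random.\<close>

definition riffle_pmf :: "nat \<Rightarrow> nat list pmf" where
  "riffle_pmf n =
     bind_pmf (binomial_pmf n (1/2))
       (\<lambda>t. pmf_of_set (shuffles [1..<Suc t] [Suc t..<Suc n]))"

text \<open>The argument \<open>rs\<close> is the list of the cards revealed so far, in the order of their
  appearance.  If they are not just \<open>1, 2, \<dots>\<close>, then \<open>j\<close> is the length of the initial run
  \<open>1, \<dots>, j\<close> and \<open>m\<close> is the card that broke it; \<open>A\<close> and \<open>B\<close> are what remains of the two
  increasing sequences.\<close>

definition optimal_guess :: "nat \<Rightarrow> nat list \<Rightarrow> nat" where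
  "optimal_guess n rs =
     (if rs = [1..<Suc (length rs)] then Suc (length rs)
      else let j = (LEAST j. rs ! j \<noteq> Suc j);
               m = rs ! j;
               A = {j + 1..<m} - set rs;
               B = {m + 1..n} - set rs
           in if card A < card B then Min B else Min A)"

text \<open>Number of correct guesses on the given deck, each guess depending only on the cards
  revealed before it.\<close>

definition correct_guesses :: "nat \<Rightarrow> nat list \<Rightarrow> nat" where
  "correct_guesses n deck = card {i \<in> {..<n}. optimal_guess n (take i deck) = deck ! i}"

abbreviation X :: "nat \<Rightarrow> nat list \<Rightarrow> real" where
  "X n deck \<equiv> real (correct_guesses n deck)"

definition mean_X :: "nat \<Rightarrow> real" where
  "mean_X n = measure_pmf.expectation (riffle_pmf n) (X n)"

definition central_moment_X :: "nat \<Rightarrow> nat \<Rightarrow> real" where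
  "central_moment_X k n = measure_pmf.expectation (riffle_pmf n) (\<lambda>d. (X n d - mean_X n) ^ k)"

definition skewness_X :: "nat \<Rightarrow> real" where
  "skewness_X n = central_moment_X 3 n / central_moment_X 2 n powr (3/2)"

definition standardized_law_X :: "nat \<Rightarrow> real measure" where
  "standardized_law_X n =
     distr (measure_pmf (riffle_pmf n)) borel
       (\<lambda>d. (X n d - mean_X n) / sqrt (measure_pmf.variance (riffle_pmf n) (X n)))"

end

theory Submission
  imports Defs "HOL-Real_Asymp.Real_Asymp"
begin

text \<open>A shuffled deck is coded by \<open>n\<close> fair coin tosses that say which pile each card comes from.  After the
first card of the bottom pile the player guesses the larger of the two remaining piles.  Each
hit away from a tie brings the piles closer and each miss drives them apart, so hits minus misses are
the initial difference of the pile sizes plus a contribution from the ties.  Read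
backwards, the difference is a simple random walk started at \<open>0\<close>, and the contribution of the ties
is essentially its local time at \<open>0\<close>; so in the scaling limit the sum has the law of a
three-dimensional Bessel process, as in the theorems of Levy and Pitman on \<open>\<bar>B\<bar> + L\<close> and
\<open>2 M - B\<close>.  Hence the law of \<open>(2 X - n) / sqrt n\<close> is close to that of the norm of a standard normal vector in three dimensions, which is nonnegative and skewed.

The correspondence is exact already for finite decks.  The key is \<open>joint_uniform\<close>: given the excess
of hits over misses, the difference of the pile sizes is uniform on the possible values.  Therefore
the excess plus one is a Markov chain with the transitions of a discrete Bessel process
(\<open>avg_bessel_Suc\<close>), and its first three moments have closed forms in central binomial
probabilities, which Wallis' product evaluates asymptotically.  The guesses before the break add
a geometrically distributed number, which does not affect the leading order of the moments
(\<open>half_recurrence_asymp\<close>).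

With \<open>s = sqrt (2 / pi)\<close>, the limits \<open>2 s\<close>, \<open>3\<close> and \<open>8 s\<close> of the normalised moments give the third
cumulant \<open>s * (32 / pi - 10)\<close>, which is not \<open>0\<close> because \<open>pi < 16 / 5\<close>; so the skewness has a limit other
than \<open>0\<close>.  Convergence to the normal law fails for a simpler reason: \<open>X\<close> is never more than a bounded
number of standard deviations below its mean.\<close>

section \<open>The game in terms of interleaving words\<close>

declare upt_Suc [simp del]

text \<open>A word records the interleaving of a shuffled deck: \<open>False\<close> stands for a card of the top pile.
Read after the break of the initial run, it determines which guesses of the larger pile succeed;
the test is strict because a tie goes to the top pile, which has the lower card numbers.\<close>

fun majority_hits :: "bool list \<Rightarrow> nat" where
  "majority_hits [] = 0"
| "majority_hits (x # w) =
     (if x = (count_list (x # w) False < count_list (x # w) True) then 1 else 0) + majority_hits w"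

text \<open>The first \<open>True\<close> breaks the run and is a miss, except when the top pile is already exhausted: then
the deck is in its original order and the player, who keeps guessing the next card, is always
right.\<close>

fun hits :: "bool list \<Rightarrow> nat" where
  "hits [] = 0"
| "hits (False # w) = Suc (hits w)"
| "hits (True # w) = (if False \<in> set w then majority_hits w else Suc (length w))"

text \<open>The correct guesses on the suffix \<open>q\<close> when \<open>p\<close> has been revealed: a form of \<open>correct_guesses\<close> that allows
induction on the rest of the deck.\<close>

fun score :: "nat \<Rightarrow> nat list \<Rightarrow> nat list \<Rightarrow> nat" where
  "score n p [] = 0"
| "score n p (x # q) = (if optimal_guess n p = x then 1 else 0) + score n (p @ [x]) q"

lemma score_eq_card:
  "score n p q = card {i \<in> {..<length q}. optimal_guess n (p @ take i q) = q ! i}"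
proof (induction q arbitrary: p)
  case (Cons x q)
  have "{i \<in> {..<length (x # q)}. optimal_guess n (p @ take i (x # q)) = (x # q) ! i} =
     (if optimal_guess n p = x then {0} else {}) \<union>
     Suc ` {i \<in> {..<length q}. optimal_guess n ((p @ [x]) @ take i q) = q ! i}" (is "?L = ?A \<union> ?B")
  proof (rule set_eqI)
    fix i show "i \<in> ?L \<longleftrightarrow> i \<in> ?A \<union> ?B" by (cases i) auto
  qed
  moreover have "card (?A \<union> ?B) = card ?A + card ?B"
    by (rule card_Un_disjoint) auto
  moreover have "card ?B = score n (p @ [x]) q"
    using Cons.IH[of "p @ [x]"] by (simp add: card_image)
  ultimately show ?case by simp
qed simp

lemma correct_guesses_eq_score: "length d = n \<Longrightarrow> correct_guesses n d = score n [] d"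
  by (simp add: correct_guesses_def score_eq_card)

lemma optimal_guess_sorted: "optimal_guess n [Suc 0..<Suc j] = Suc j"
  by (simp add: optimal_guess_def)

text \<open>Once the run is broken, the revealed cards are the initial segments \<open>{1..a}\<close> and \<open>{t+1..b}\<close> of
the two piles.  The card that broke the run is the first of the bottom pile, so it reveals the cut
\<open>t\<close>, and the sets that the strategy compares are what is left of the piles.\<close>

lemma optimal_guess_after_break:
  assumes "j < t" "t \<le> n" "a \<le> t" "t < b" "b \<le> n" "a < t \<or> b < n"
    and p: "p = [1..<Suc j] @ Suc t # r" and set_p: "set p = {1..a} \<union> {Suc t..b}"
  shows "optimal_guess n p = (if t - a < n - b then Suc b else Suc a)"
proof -
  have nth: "p ! i = Suc i" if "i < j" for i
    using that by (simp add: p nth_append)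
  have nthj: "p ! j = Suc t"
    by (simp add: p nth_append)
  have ns: "p \<noteq> [1..<Suc (length p)]"
  proof
    assume "p = [1..<Suc (length p)]"
    moreover have "j < length p" by (simp add: p)
    ultimately have "p ! j = Suc j" by (metis add.commute diff_Suc_1 nth_upt plus_1_eq_Suc Suc_less_eq)
    with nthj \<open>j < t\<close> show False by simp
  qed
  have least: "(LEAST i. p ! i \<noteq> Suc i) = j"
  proof (rule Least_equality)
    show "p ! j \<noteq> Suc j" using nthj \<open>j < t\<close> by simp
    show "j \<le> i" if "p ! i \<noteq> Suc i" for i using nth[of i] that by (meson not_le)
  qed
  have "j \<le> a"
  proof (cases j)
    case (Suc k)
    then have "j \<in> set p" by (simp add: p)
    with set_p \<open>j < t\<close> show ?thesis by auto
  qed simp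
  have A: "{j + 1..<Suc t} - set p = {Suc a..t}"
    unfolding set_p using \<open>j \<le> a\<close> assms(1-5) by auto
  have B: "{Suc t + 1..n} - set p = {Suc b..n}"
    unfolding set_p using assms(1-5) by auto
  have mins: "Min {Suc k..l} = Suc k" if "k < l" for k l :: nat
    using that by (intro Min_eqI) auto
  show ?thesis
    unfolding optimal_guess_def Let_def if_not_P[OF ns] least nthj A B
    using assms(6) by (auto simp: mins)
qed

lemma count_map_shuffle:
  assumes "q \<in> shuffles xs ys" "\<And>x. x \<in> set xs \<Longrightarrow> \<not> P x" "\<And>y. y \<in> set ys \<Longrightarrow> P y"
  shows "count_list (map P q) False = length xs \<and> count_list (map P q) True = length ys"
  using assms
proof (induction q arbitrary: xs ys)
  case (Cons z q)
  from Cons.prems(1) consider xs' where "xs = z # xs'" "q \<in> shuffles xs' ys"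
    | ys' where "ys = z # ys'" "q \<in> shuffles xs ys'"
    by (auto elim: shufflesE)
  then show ?case
  proof cases
    case 1
    then show ?thesis using Cons.IH[of xs' ys] Cons.prems(2,3) by simp
  next
    case 2
    then show ?thesis using Cons.IH[of xs ys'] Cons.prems(2,3) by simp
  qed
qed simp

lemma shuffle_intervals_cases:
  assumes "x # q \<in> shuffles [Suc a..<Suc t] [Suc b..<Suc n]"
  obtains "a < t" "x = Suc a" "q \<in> shuffles [Suc (Suc a)..<Suc t] [Suc b..<Suc n]"
  | "b < n" "x = Suc b" "q \<in> shuffles [Suc a..<Suc t] [Suc (Suc b)..<Suc n]"
proof -
  have hd_tl: "[Suc k..<Suc l] \<noteq> [] \<longleftrightarrow> k < l" "k < l \<Longrightarrow> hd [Suc k..<Suc l] = Suc k"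
    "tl [Suc k..<Suc l] = [Suc (Suc k)..<Suc l]" for k l
    by auto
  from assms show ?thesis
    unfolding Cons_in_shuffles_iff hd_tl using hd_tl(2) that by metis
qed

lemma score_after_break:
  assumes "j < t" "t \<le> n" "a \<le> t" "t < b" "b \<le> n"
    and "p = [1..<Suc j] @ Suc t # r" and "set p = {1..a} \<union> {Suc t..b}"
    and "q \<in> shuffles [Suc a..<Suc t] [Suc b..<Suc n]"
  shows "score n p q = majority_hits (map (\<lambda>c. t < c) q)"
  using assms
proof (induction q arbitrary: p r a b)
  case (Cons x q)
  have counts: "count_list (map (\<lambda>c. t < c) (x # q)) False = t - a"
    "count_list (map (\<lambda>c. t < c) (x # q)) True = n - b"
    using count_map_shuffle[OF Cons.prems(8), of "\<lambda>c. t < c"] Cons.prems(4)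
    by (auto simp: less_Suc_eq_le)
  from Cons.prems(8) show ?case
  proof (cases rule: shuffle_intervals_cases)
    case 1
    have "set (p @ [x]) = {1..Suc a} \<union> {Suc t..b}"
      using 1 by (auto simp: Cons.prems(7))
    moreover have "p @ [x] = [1..<Suc j] @ Suc t # r @ [x]"
      by (simp add: Cons.prems(6))
    ultimately have "score n (p @ [x]) q = majority_hits (map (\<lambda>c. t < c) q)"
      using 1 Cons.prems(1-5)
      by (intro Cons.IH[where a = "Suc a" and b = "b" and r = "r @ [x]"]) (assumption | simp)+
    moreover have "optimal_guess n p = (if t - a < n - b then Suc b else Suc a)"
      using optimal_guess_after_break[OF Cons.prems(1-5) _ Cons.prems(6,7)] 1 by blast
    ultimately show ?thesis using 1 Cons.prems(3,4) counts by auto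
  next
    case 2
    have "set (p @ [x]) = {1..a} \<union> {Suc t..Suc b}"
      using 2 Cons.prems(4) by (auto simp: Cons.prems(7))
    moreover have "p @ [x] = [1..<Suc j] @ Suc t # r @ [x]"
      by (simp add: Cons.prems(6))
    ultimately have "score n (p @ [x]) q = majority_hits (map (\<lambda>c. t < c) q)"
      using 2 Cons.prems(1-5)
      by (intro Cons.IH[where a = "a" and b = "Suc b" and r = "r @ [x]"]) (assumption | simp)+
    moreover have "optimal_guess n p = (if t - a < n - b then Suc b else Suc a)"
      using optimal_guess_after_break[OF Cons.prems(1-5) _ Cons.prems(6,7)] 2 by blast
    ultimately show ?thesis using 2 Cons.prems(3,4) counts by auto
  qed
qed simp

lemma score_sorted: "j \<le> n \<Longrightarrow> score n [1..<Suc j] [Suc j..<Suc n] = n - j"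
proof (induction "n - j" arbitrary: j)
  case (Suc k)
  have e: "[Suc j..<Suc n] = Suc j # [Suc (Suc j)..<Suc n]"
    using Suc by (subst upt_conv_Cons) auto
  have "score n ([1..<Suc j] @ [Suc j]) [Suc (Suc j)..<Suc n] = n - Suc j"
    using Suc.hyps(1)[of "Suc j"] Suc.hyps(2) Suc.prems by (simp add: upt_Suc_append)
  then show ?case
    unfolding e using Suc.hyps(2) by (simp add: optimal_guess_sorted)
qed simp

lemma score_before_break:
  assumes "j \<le> t" "t \<le> n" "q \<in> shuffles [Suc j..<Suc t] [Suc t..<Suc n]"
  shows "score n [1..<Suc j] q = hits (map (\<lambda>c. t < c) q)"
  using assms
proof (induction q arbitrary: j)
  case (Cons x q)
  from Cons.prems(3) show ?case
  proof (cases rule: shuffle_intervals_cases)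
    case 1
    then show ?thesis using Cons.IH[of "Suc j"] Cons.prems
      by (auto simp: optimal_guess_sorted upt_Suc_append)
  next
    case 2
    show ?thesis
    proof (cases "j < t")
      case True
      have "count_list (map (\<lambda>c. t < c) q) False = length [Suc j..<Suc t]"
        using count_map_shuffle[OF 2(3), of "\<lambda>c. t < c"] by auto
      then have "False \<in> set (map (\<lambda>c. t < c) q)"
        using True by (metis count_notin length_upt diff_is_0_eq Suc_le_mono not_le)
      moreover have "score n ([1..<Suc j] @ [x]) q = majority_hits (map (\<lambda>c. t < c) q)"
        by (rule score_after_break[OF True Cons.prems(2), of j "Suc t" _ "[]"])
           (use 2 Cons.prems in auto)
      ultimately show ?thesis using 2 True
        by (auto simp: optimal_guess_sorted)
    next
      case False
      with Cons.prems have "j = t" by simp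
      then have q: "x # q = [Suc j..<Suc n]" using Cons.prems by simp
      have "False \<notin> set (map (\<lambda>c. t < c) q)"
        using q 2 \<open>j = t\<close> by (auto simp: set_shuffles)
      moreover have "score n [1..<Suc j] (x # q) = n - j"
        unfolding q using \<open>j = t\<close> Cons.prems by (intro score_sorted) simp
      moreover have "Suc (length q) = n - j" using arg_cong[OF q, of length] by simp
      moreover have "map (\<lambda>c. t < c) (x # q) = True # map (\<lambda>c. t < c) q"
        using 2(2) by simp
      ultimately show ?thesis by (simp only: hits.simps if_not_P length_map simp_thms if_False)
    qed
  qed
qed simp

text \<open>The number of correct guesses depends on the deck only through its word, which for a random
shuffle consists of fair coin tosses.\<close>

lemma correct_guesses_shuffle:
  assumes "t \<le> n" "d \<in> shuffles [1..<Suc t] [Suc t..<Suc n]"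
  shows "correct_guesses n d = hits (map (\<lambda>c. t < c) d)"
proof -
  have "length d = n" using length_shuffles[OF assms(2)] assms(1) by simp
  then show ?thesis
    using score_before_break[of 0 t n d] assms by (simp add: correct_guesses_eq_score)
qed

section \<open>Riffle shuffles as coin tosses\<close>

definition words :: "nat \<Rightarrow> bool list set" where
  "words n = {w. length w = n}"

definition avg :: "nat \<Rightarrow> (bool list \<Rightarrow> real) \<Rightarrow> real" where
  "avg n f = (\<Sum>w\<in>words n. f w) / 2 ^ n"

lemma words_0 [simp]: "words 0 = {[]}"
  by (auto simp: words_def)

lemma words_Suc: "words (Suc n) = Cons False ` words n \<union> Cons True ` words n"
proof -
  have "w \<in> words (Suc n) \<longleftrightarrow> w \<in> Cons False ` words n \<union> Cons True ` words n" for w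
    by (cases w; cases "hd w") (auto simp: words_def image_iff)
  then show ?thesis by blast
qed

lemma finite_words [simp]: "finite (words n)"
  by (induction n) (auto simp: words_Suc)

lemma sum_words_Suc:
  "(\<Sum>w\<in>words (Suc n). f w) = (\<Sum>w\<in>words n. f (False # w)) + (\<Sum>w\<in>words n. f (True # w))"
  for f :: "bool list \<Rightarrow> 'a :: comm_monoid_add"
  unfolding words_Suc by (subst sum.union_disjoint) (auto simp: sum.reindex)

lemma card_words_Suc:
  "card {w \<in> words (Suc n). P w} =
     card {w \<in> words n. P (False # w)} + card {w \<in> words n. P (True # w)}"
  using sum_words_Suc[of "\<lambda>w. if P w then 1 else (0::nat)" n]
  by (simp add: sum.If_cases Int_def)

lemma avg_0 [simp]: "avg 0 f = f []"
  by (simp add: avg_def)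

lemma avg_Suc: "avg (Suc n) f = (avg n (\<lambda>w. f (False # w)) + avg n (\<lambda>w. f (True # w))) / 2"
  by (simp add: avg_def sum_words_Suc add_divide_distrib)

lemma avg_add: "avg n (\<lambda>w. f w + g w) = avg n f + avg n g"
  by (simp add: avg_def sum.distrib add_divide_distrib)

lemma avg_cmult: "avg n (\<lambda>w. c * f w) = c * avg n f"
  by (simp add: avg_def sum_distrib_left)

lemma avg_const [simp]: "avg n (\<lambda>w. c) = c"
  by (induction n) (simp_all add: avg_Suc)

lemma avg_cong: "(\<And>w. w \<in> words n \<Longrightarrow> f w = g w) \<Longrightarrow> avg n f = avg n g"
  by (simp add: avg_def)

lemma card_words_count: "card {w \<in> words n. count_list w False = k} = n choose k"
proof (induction n arbitrary: k)
  case 0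
  have "{w \<in> words 0. count_list w False = k} = (if k = 0 then {[]} else {})" by auto
  then show ?case by simp
next
  case (Suc n)
  then show ?case by (cases k) (simp_all add: card_words_Suc)
qed

lemma count_False_True: "count_list w False + count_list w True = length w"
  by (induction w) auto

text \<open>The word of an interleaving of two separated lists determines it, and every word with the right
number of letters occurs.\<close>

lemma bij_betw_shuffles_words:
  assumes "\<And>x. x \<in> set xs \<Longrightarrow> \<not> P x" "\<And>y. y \<in> set ys \<Longrightarrow> P y"
  shows "bij_betw (map P) (shuffles xs ys)
     {w \<in> words (length xs + length ys). count_list w False = length xs}"
proof (rule bij_betw_imageI)
  have "z = z'" if "z \<in> shuffles xs ys" "z' \<in> shuffles xs ys" "map P z = map P z'" for z z'
    using that assms
  proof (induction z arbitrary: z' xs ys)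
    case (Cons a z)
    then obtain a' y where z': "z' = a' # y" by (cases z') auto
    from Cons.prems(1) consider xs' where "xs = a # xs'" "z \<in> shuffles xs' ys"
      | ys' where "ys = a # ys'" "z \<in> shuffles xs ys'"
      by (auto elim: shufflesE)
    then show ?case
    proof cases
      case 1
      with Cons.prems z' have "\<not> P a'" by auto
      with Cons.prems z' have "y \<in> shuffles xs' ys" "a' = a"
        by (auto simp: Cons_in_shuffles_iff 1)
      then show ?thesis using Cons.IH[of xs' ys y] Cons.prems 1 z' by auto
    next
      case 2
      with Cons.prems z' have "P a'" by auto
      with Cons.prems z' have "y \<in> shuffles xs ys'" "a' = a"
        by (auto simp: Cons_in_shuffles_iff 2)
      then show ?thesis using Cons.IH[of xs ys' y] Cons.prems 2 z' by auto
    qed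
  qed auto
  then show "inj_on (map P) (shuffles xs ys)" by (auto intro: inj_onI)
  have "map P z \<in> {w \<in> words (length xs + length ys). count_list w False = length xs}"
    if "z \<in> shuffles xs ys" for z
    using count_map_shuffle[OF that assms] length_shuffles[OF that] by (simp add: words_def)
  moreover have "w \<in> map P ` shuffles xs ys"
    if "length w = length xs + length ys" "count_list w False = length xs" for w
    using that assms
  proof (induction w arbitrary: xs ys)
    case (Cons b w)
    show ?case
    proof (cases b)
      case True
      have "count_list w False \<le> length w" by (rule count_le_length)
      with Cons.prems True obtain y ys' where ys: "ys = y # ys'" by (cases ys) auto
      have "w \<in> map P ` shuffles xs ys'"
        using Cons.prems True ys by (intro Cons.IH) auto
      then obtain z where "z \<in> shuffles xs ys'" "w = map P z" by blast
      then have "y # z \<in> shuffles xs ys" "b # w = map P (y # z)"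
        using ys True Cons.prems(4) by (auto intro: Cons_in_shuffles_rightI)
      then show ?thesis by (metis image_eqI)
    next
      case False
      with Cons.prems obtain x xs' where xs: "xs = x # xs'" by (cases xs) auto
      have "w \<in> map P ` shuffles xs' ys"
        using Cons.prems False xs by (intro Cons.IH) auto
      then obtain z where "z \<in> shuffles xs' ys" "w = map P z" by blast
      then have "x # z \<in> shuffles xs ys" "b # w = map P (x # z)"
        using xs False Cons.prems(3) by (auto intro: Cons_in_shuffles_leftI)
      then show ?thesis by (metis image_eqI)
    qed
  qed auto
  ultimately show "map P ` shuffles xs ys =
      {w \<in> words (length xs + length ys). count_list w False = length xs}"
    by (auto simp: words_def)
qed

lemma set_pmf_binomial_subset: "set_pmf (binomial_pmf n (1/2)) \<subseteq> {..n}"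
  by (simp add: set_pmf_binomial_eq)

lemma shuffles_nonempty: "shuffles xs ys \<noteq> {}"
  using splice_in_shuffles by fast

text \<open>A cut after \<open>t\<close> cards has probability \<open>(n choose t) / 2 ^ n\<close>, and there are exactly
\<open>n choose t\<close> words with \<open>t\<close> letters \<open>False\<close>; so all \<open>2 ^ n\<close> words are equally likely.\<close>

lemma expectation_riffle:
  "measure_pmf.expectation (riffle_pmf n) (\<lambda>d. f (correct_guesses n d)) = avg n (\<lambda>w. f (hits w))"
  for f :: "nat \<Rightarrow> real"
proof -
  define S where "S t = shuffles [1..<Suc t] [Suc t..<Suc n]" for t
  have inner: "pmf (binomial_pmf n (1/2)) t *
      measure_pmf.expectation (pmf_of_set (S t)) (\<lambda>d. f (correct_guesses n d)) =
      (\<Sum>w | w \<in> words n \<and> count_list w False = t. f (hits w)) / 2 ^ n" if "t \<le> n" for t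
  proof -
    have bij: "bij_betw (map (\<lambda>c. t < c)) (S t) {w \<in> words n. count_list w False = t}"
      using bij_betw_shuffles_words[of "[1..<Suc t]" "\<lambda>c. t < c" "[Suc t..<Suc n]"] that
      by (simp add: S_def)
    have card: "card (S t) = n choose t"
      using bij_betw_same_card[OF bij] by (simp add: card_words_count)
    have "(\<Sum>d\<in>S t. f (correct_guesses n d)) = (\<Sum>d\<in>S t. f (hits (map (\<lambda>c. t < c) d)))"
      by (intro sum.cong refl) (simp add: S_def correct_guesses_shuffle[OF that])
    also have "\<dots> = (\<Sum>w | w \<in> words n \<and> count_list w False = t. f (hits w))"
      by (rule sum.reindex_bij_betw[OF bij])
    finally have sum: "(\<Sum>d\<in>S t. f (correct_guesses n d)) =
        (\<Sum>w | w \<in> words n \<and> count_list w False = t. f (hits w))" .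
    have "(1/2 :: real) ^ t * (1/2) ^ (n - t) = 1 / 2 ^ n"
      using that by (simp add: power_add[symmetric] power_one_over)
    moreover have "S t \<noteq> {}" "finite (S t)" "real (n choose t) \<noteq> 0"
      using that by (auto simp: S_def shuffles_nonempty)
    ultimately show ?thesis
      by (simp add: integral_pmf_of_set card sum mult.assoc[symmetric])
  qed
  have "measure_pmf.expectation (riffle_pmf n) (\<lambda>d. f (correct_guesses n d)) =
     (\<Sum>t\<le>n. pmf (binomial_pmf n (1/2)) t *
        measure_pmf.expectation (pmf_of_set (S t)) (\<lambda>d. f (correct_guesses n d)))"
    unfolding riffle_pmf_def S_def
    by (subst pmf_expectation_bind[OF _ _ set_pmf_binomial_subset])
       (auto simp: set_pmf_of_set shuffles_nonempty)
  also have "\<dots> = (\<Sum>t\<le>n. \<Sum>w | w \<in> words n \<and> count_list w False = t. f (hits w)) / 2 ^ n"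
    by (simp add: inner sum_divide_distrib del: pmf_binomial)
  also have "(\<Sum>t\<le>n. \<Sum>w | w \<in> words n \<and> count_list w False = t. f (hits w)) = (\<Sum>w\<in>words n. f (hits w))"
    by (rule sum.group[OF finite_words finite_atMost]) (auto simp: words_def count_le_length)
  finally show ?thesis by (simp add: avg_def)
qed

lemma riffle_support:
  assumes "d \<in> set_pmf (riffle_pmf n)"
  shows "\<exists>w \<in> words n. correct_guesses n d = hits w"
proof -
  from assms obtain t where t: "t \<in> set_pmf (binomial_pmf n (1/2))"
      "d \<in> shuffles [1..<Suc t] [Suc t..<Suc n]"
    by (auto simp: riffle_pmf_def set_pmf_of_set shuffles_nonempty)
  from t(1) have "t \<le> n" using set_pmf_binomial_subset by blast
  with t(2) show ?thesis
    using correct_guesses_shuffle[of t n d] length_shuffles[OF t(2)]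
    by (intro bexI[of _ "map (\<lambda>c. t < c) d"]) (simp_all add: words_def)
qed

section \<open>The walk of excess and lead\<close>

text \<open>Prepending letters to a word lets the end of the game grow backwards in time, which turns the
difference of the pile sizes into a simple random walk started at \<open>0\<close>.\<close>

definition lead :: "bool list \<Rightarrow> int" where
  "lead w = int (count_list w False) - int (count_list w True)"

text \<open>Hits minus misses of the majority strategy.\<close>

definition excess :: "bool list \<Rightarrow> int" where
  "excess w = 2 * int (majority_hits w) - int (length w)"

lemma lead_simps [simp]: "lead [] = 0" "lead (False # w) = lead w + 1" "lead (True # w) = lead w - 1"
  by (simp_all add: lead_def)

lemma excess_simps [simp]:
  "excess [] = 0"
  "excess (False # w) = excess w + (if lead w \<ge> -1 then 1 else -1)"
  "excess (True # w) = excess w + (if lead w \<le> 0 then 1 else -1)"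
  by (auto simp: excess_def lead_def)

definition joint :: "nat \<Rightarrow> int \<Rightarrow> int \<Rightarrow> nat" where
  "joint n v s = card {w \<in> words n. excess w = v \<and> lead w = s}"

lemma joint_Suc:
  "joint (Suc n) v s =
     (if s \<ge> 0 then joint n (v - 1) (s - 1) + joint n (v + 1) (s + 1)
      else joint n (v + 1) (s - 1) + joint n (v - 1) (s + 1))"
proof -
  have "{w \<in> words n. excess (False # w) = v \<and> lead (False # w) = s} =
      {w \<in> words n. excess w = (if s \<ge> 0 then v - 1 else v + 1) \<and> lead w = s - 1}"
    by auto
  moreover have "{w \<in> words n. excess (True # w) = v \<and> lead (True # w) = s} =
      {w \<in> words n. excess w = (if s \<ge> 0 then v + 1 else v - 1) \<and> lead w = s + 1}"
    by auto
  ultimately show ?thesis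
    unfolding joint_def card_words_Suc by simp
qed

text \<open>Given its excess \<open>v\<close>, a uniform word has a lead distributed uniformly on
\<open>{-v, -v + 2, \<dots>, v}\<close>.  This is a discrete relative of Pitman's theorem on
\<open>2 M - S\<close>; it is what makes the excess a Markov chain.  The induction step only has to
see that the two predecessors of an admissible pair in \<open>joint_Suc\<close> are admissible again; the one
failure is at \<open>v = s = 0\<close>, where the offending predecessor has negative excess and
multiplicity \<open>0\<close>.\<close>

lemma joint_uniform:
  "joint n v s = (if \<bar>s\<bar> \<le> v \<and> even (v - s) then joint n v v else 0)"
proof (induction n arbitrary: v s)
  case 0
  have "{w \<in> words 0. excess w = v \<and> lead w = s} = (if v = 0 \<and> s = 0 then {[]} else {})" for v s
    by auto
  then show ?case by (auto simp: joint_def)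
next
  case (Suc n)
  define c where "c v = joint n v v" for v
  have IH: "joint n v s = (if \<bar>s\<bar> \<le> v \<and> even (v - s) then c v else 0)" for v s
    using Suc.IH[of v s] by (simp add: c_def)
  have neg: "c v = 0" if "v < 0" for v
    using Suc.IH[of v v] that by (simp add: c_def)
  have diag: "joint (Suc n) v v = (if v \<ge> 0 then c (v - 1) + c (v + 1) else 0)" for v
    by (auto simp: joint_Suc IH neg)
  have "joint (Suc n) v s = (if \<bar>s\<bar> \<le> v \<and> even (v - s) then c (v - 1) + c (v + 1) else 0)"
  proof (cases "s = 0 \<and> v = 0")
    case True
    then show ?thesis by (simp add: joint_Suc IH neg)
  next
    case False
    have "s \<ge> 0 \<Longrightarrow> even (v - s) \<Longrightarrow> \<bar>s - 1\<bar> \<le> v - 1 \<longleftrightarrow> \<bar>s\<bar> \<le> v"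
      using False by presburger
    moreover have "s \<ge> 0 \<Longrightarrow> \<bar>s + 1\<bar> \<le> v + 1 \<longleftrightarrow> \<bar>s\<bar> \<le> v"
      "s < 0 \<Longrightarrow> \<bar>s - 1\<bar> \<le> v + 1 \<longleftrightarrow> \<bar>s\<bar> \<le> v" "s < 0 \<Longrightarrow> \<bar>s + 1\<bar> \<le> v - 1 \<longleftrightarrow> \<bar>s\<bar> \<le> v"
      by auto
    moreover have "even (v - 1 - (s - 1)) = even (v - s)" "even (v + 1 - (s + 1)) = even (v - s)"
      "even (v + 1 - (s - 1)) = even (v - s)" "even (v - 1 - (s + 1)) = even (v - s)"
      by presburger+
    ultimately show ?thesis by (auto simp: joint_Suc IH)
  qed
  then show ?case by (auto simp: diag)
qed

lemma joint_diag_neg: "v < 0 \<Longrightarrow> joint n v v = 0"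
  by (subst joint_uniform) simp

lemma joint_diag_Suc: "v \<ge> 0 \<Longrightarrow> joint (Suc n) v v = joint n (v - 1) (v - 1) + joint n (v + 1) (v + 1)"
  by (simp add: joint_Suc)

lemma majority_hits_le: "majority_hits w \<le> length w"
  by (induction w) auto

text \<open>By \<open>joint_uniform\<close> no word attains a pair with \<open>\<bar>s\<bar> > v\<close>.\<close>

lemma excess_range:
  assumes "w \<in> words n"
  shows "\<bar>lead w\<bar> \<le> excess w" "excess w \<in> {0..int n}"
proof -
  have "joint n (excess w) (lead w) \<noteq> 0"
    using assms by (auto simp: joint_def)
  then show "\<bar>lead w\<bar> \<le> excess w" by (subst (asm) joint_uniform) (auto split: if_splits)
  moreover have "excess w \<le> int n"
    using majority_hits_le[of w] assms by (simp add: excess_def words_def)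
  ultimately show "excess w \<in> {0..int n}" by simp
qed

lemma joint_diag_large: "v > int n \<Longrightarrow> joint n v v = 0"
  using excess_range(2) by (fastforce simp: joint_def)

lemma joint_sum_lead:
  assumes "v \<ge> 0"
  shows "card {w \<in> words n. excess w = v} = nat (v + 1) * joint n v v"
proof -
  have "{w \<in> words n. excess w = v} = (\<Union>s\<in>{-v..v}. {w \<in> words n. excess w = v \<and> lead w = s})"
    using excess_range(1) by fastforce
  then have "card {w \<in> words n. excess w = v} = (\<Sum>s\<in>{-v..v}. joint n v s)"
    by (simp add: joint_def) (subst card_UN_disjoint; auto)
  also have "\<dots> = (\<Sum>s | s \<in> {-v..v} \<and> even (v - s). joint n v v)"
  proof (rule sum.mono_neutral_cong_right)
    have eq: "joint n v s = (if even (v - s) then joint n v v else 0)" if "s \<in> {-v..v}" for s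
      using that joint_uniform[of n v s] by (simp add: abs_le_iff split: if_splits)
    show "\<forall>s\<in>{-v..v} - {s. s \<in> {-v..v} \<and> even (v - s)}. joint n v s = 0"
      using eq by (metis (mono_tags, lifting) DiffE mem_Collect_eq)
    show "joint n v s = joint n v v" if "s \<in> {s. s \<in> {-v..v} \<and> even (v - s)}" for s
      using eq[of s] that by (simp only: mem_Collect_eq simp_thms if_True)
  qed auto
  also have "{s. s \<in> {-v..v} \<and> even (v - s)} = (\<lambda>i. v - 2 * i) ` {0..v}"
  proof (intro set_eqI iffI)
    fix s assume "s \<in> {s. s \<in> {-v..v} \<and> even (v - s)}"
    then show "s \<in> (\<lambda>i. v - 2 * i) ` {0..v}"
      by (intro image_eqI[of _ _ "(v - s) div 2"]) auto
  qed auto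
  finally show ?thesis
    by (simp add: card_image inj_on_def)
qed

lemma sum_words_excess:
  "(\<Sum>w\<in>words n. g (excess w)) = (\<Sum>v\<in>{0..int n}. (real_of_int v + 1) * joint n v v * g v)"
  for g :: "int \<Rightarrow> real"
proof -
  have "(\<Sum>w\<in>words n. g (excess w)) = (\<Sum>v\<in>{0..int n}. \<Sum>w | w \<in> words n \<and> excess w = v. g (excess w))"
    using excess_range(2) by (intro sum.group[symmetric]) auto
  also have "\<dots> = (\<Sum>v\<in>{0..int n}. (real_of_int v + 1) * joint n v v * g v)"
    by (intro sum.cong refl) (auto simp: joint_sum_lead)
  finally show ?thesis .
qed

text \<open>The excess plus one is the discrete analogue of the three-dimensional Bessel process: the
number of words with \<open>bessel w = r\<close> is \<open>r\<close> times a solution of the recurrence of simple random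
walk, as \<open>joint_sum_lead\<close> and \<open>joint_diag_Suc\<close> show.\<close>

definition bessel :: "bool list \<Rightarrow> real" where
  "bessel w = real_of_int (excess w) + 1"

lemma bessel_ge_1: "bessel w \<ge> 1"
  using excess_range(2)[of w "length w"] by (simp add: bessel_def words_def)

text \<open>From \<open>r\<close> the process moves to \<open>r + 1\<close> with probability \<open>(r + 1) / (2 r)\<close> and to
\<open>r - 1\<close> with probability \<open>(r - 1) / (2 r)\<close>.\<close>

lemma avg_bessel_Suc:
  "avg (Suc n) (\<lambda>w. g (bessel w)) =
   avg n (\<lambda>w. ((bessel w + 1) * g (bessel w + 1) + (bessel w - 1) * g (bessel w - 1)) / (2 * bessel w))"
proof -
  define c where "c v = real (joint n v v)" for v
  define r where "r = real_of_int"
  have c0: "c v = 0" if "v \<notin> {0..int n}" for v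
    using that joint_diag_neg[of v n] joint_diag_large[of n v] by (auto simp: c_def)
  have "(\<Sum>w\<in>words (Suc n). g (bessel w)) =
      (\<Sum>v\<in>{0..int (Suc n)}. (r v + 1) * (c (v - 1) + c (v + 1)) * g (r v + 1))"
    unfolding bessel_def by (subst sum_words_excess) (simp add: joint_diag_Suc c_def r_def)
  also have "\<dots> = (\<Sum>v\<in>{0..int (Suc n)}. c (v - 1) * ((r v + 1) * g (r v + 1))) +
       (\<Sum>v\<in>{0..int (Suc n)}. c (v + 1) * ((r v + 1) * g (r v + 1)))"
    by (simp add: algebra_simps sum.distrib)
  also have "(\<Sum>v\<in>{0..int (Suc n)}. c (v - 1) * ((r v + 1) * g (r v + 1))) =
       (\<Sum>v\<in>{0..int n}. c v * ((r v + 2) * g (r v + 2)))"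
    by (rule sum.reindex_bij_witness_not_neutral[where S' = "{0}" and T' = "{}"
          and i = "\<lambda>v. v + 1" and j = "\<lambda>v. v - 1"])
       (auto simp: c0 r_def add.commute)
  also have "(\<Sum>v\<in>{0..int (Suc n)}. c (v + 1) * ((r v + 1) * g (r v + 1))) =
       (\<Sum>v\<in>{0..int n}. c v * (r v * g (r v)))"
    by (rule sum.reindex_bij_witness_not_neutral[where S' = "{int n, int n + 1}" and T' = "{0}"
          and i = "\<lambda>v. v - 1" and j = "\<lambda>v. v + 1"])
       (auto simp: c0 r_def)
  also have "(\<Sum>v\<in>{0..int n}. c v * ((r v + 2) * g (r v + 2))) + (\<Sum>v\<in>{0..int n}. c v * (r v * g (r v))) =
      (\<Sum>v\<in>{0..int n}. (r v + 1) * c v *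
         (((r v + 2) * g (r v + 2) + r v * g (r v)) / (r v + 1)))"
    unfolding sum.distrib[symmetric] by (intro sum.cong refl) (auto simp: field_simps r_def)
  also have "\<dots> = (\<Sum>w\<in>words n. ((bessel w + 1) * g (bessel w + 1) + (bessel w - 1) * g (bessel w - 1)) / bessel w)"
    unfolding bessel_def using sum_words_excess[of "\<lambda>v. ((r v + 2) * g (r v + 2) + r v * g (r v)) / (r v + 1)" n]
    by (simp add: c_def r_def add.commute)
  finally show ?thesis
    by (simp add: avg_def sum_divide_distrib field_simps)
qed

text \<open>The factor \<open>r\<close> in the multiplicity of the value \<open>r\<close> cancels, and what is left counts one word
for each admissible pair of an excess with one fixed lead.  Choosing the lead \<open>0\<close> or \<open>1\<close>, whichever
has the parity of \<open>n\<close>, admits every excess that occurs, so the sum counts all words with that lead.\<close>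

lemma avg_inverse_bessel:
  "avg n (\<lambda>w. 1 / bessel w) = real (n choose (Suc n div 2)) / 2 ^ n"
proof -
  \<comment> \<open>This lead belongs to exactly \<open>Suc n div 2\<close> letters \<open>False\<close>.\<close>
  define s :: int where "s = (if odd n then 1 else 0)"
  have "(\<Sum>w\<in>words n. 1 / bessel w) = (\<Sum>v\<in>{0..int n}. real (joint n v v))"
    unfolding bessel_def by (subst sum_words_excess) auto
  also have "\<dots> = (\<Sum>v\<in>{0..int n}. real (joint n v s))"
  proof (intro sum.cong refl arg_cong[of _ _ real])
    fix v assume v: "v \<in> {0..int n}"
    show "joint n v v = joint n v s"
    proof (cases "even (v - s)")
      case True
      with v have "\<bar>s\<bar> \<le> v" unfolding s_def by (auto split: if_splits elim!: evenE oddE)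
      with True show ?thesis by (simp add: joint_uniform[of n v s])
    next
      case False
      have "excess w \<noteq> v" if "w \<in> words n" for w
        using that False by (auto simp: excess_def words_def s_def split: if_splits)
      then have "joint n v v = 0" by (auto simp: joint_def)
      with False show ?thesis by (simp add: joint_uniform[of n v s])
    qed
  qed
  also have "\<dots> = real (card (\<Union>v\<in>{0..int n}. {w \<in> words n. excess w = v \<and> lead w = s}))"
    unfolding joint_def of_nat_sum[symmetric] by (subst card_UN_disjoint) auto
  also have "(\<Union>v\<in>{0..int n}. {w \<in> words n. excess w = v \<and> lead w = s}) =
     {w \<in> words n. count_list w False = Suc n div 2}"
  proof -
    have "lead w = s \<longleftrightarrow> count_list w False = Suc n div 2" if "w \<in> words n" for w
    proof -
      have "lead w = 2 * int (count_list w False) - int n"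
        using count_False_True[of w] that by (simp add: lead_def words_def)
      then show ?thesis unfolding s_def by (cases "even n") (auto elim!: evenE oddE)
    qed
    then show ?thesis using excess_range(2) by blast
  qed
  finally show ?thesis by (simp add: avg_def card_words_count)
qed

section \<open>Moments of the Bessel chain\<close>

definition central_prob :: "nat \<Rightarrow> real" where
  "central_prob n = real (n choose (Suc n div 2)) / 2 ^ n"

definition parity :: "nat \<Rightarrow> real" where
  "parity n = (if odd n then 1 else 0)"

lemma central_prob_Suc_odd: "odd n \<Longrightarrow> central_prob (Suc n) = central_prob n"
proof -
  assume "odd n"
  then obtain m where n: "n = 2 * m + 1" by (elim oddE)
  have "(2 * m + 2) choose (m + 1) = 2 * ((2 * m + 1) choose (m + 1))"
    using binomial_symmetric[of m "2 * m + 1"] by (simp add: mult_2)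
  then show ?thesis by (simp add: central_prob_def n field_simps)
qed

lemma central_prob_Suc_even: "even n \<Longrightarrow> central_prob (Suc n) = central_prob n * (real n + 1) / (real n + 2)"
proof -
  assume "even n"
  then obtain m where n: "n = 2 * m" by (elim evenE)
  have "Suc m * (Suc (2 * m) choose Suc m) = Suc (2 * m) * (2 * m choose m)"
    using Suc_times_binomial_eq[of "2 * m" m] by (simp only: mult.commute)
  then have "(real m + 1) * real (Suc (2 * m) choose Suc m) = (2 * real m + 1) * real (2 * m choose m)"
    by (metis of_nat_mult of_nat_Suc of_nat_numeral add.commute)
  then have "real (Suc (2 * m) choose Suc m) = (2 * real m + 1) * real (2 * m choose m) / (real m + 1)"
    by (simp add: eq_divide_eq mult.commute del: binomial_Suc_Suc)
  then show ?thesis by (simp add: central_prob_def n divide_simps del: binomial_Suc_Suc)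
      (simp add: algebra_simps)
qed

text \<open>Both parities share one product, since the value at an even \<open>n > 0\<close> equals the value at
\<open>n - 1\<close>.\<close>

lemma central_prob_wallis:
  "central_prob n ^ 2 * (2 * real (Suc n div 2) + 1) * (\<Prod>k=1..Suc n div 2. 4 * real k ^ 2 / (4 * real k ^ 2 - 1)) = 1"
proof (induction n)
  case 0
  then show ?case by (simp add: central_prob_def)
next
  case (Suc n)
  show ?case
  proof (cases "even n")
    case True
    then obtain m where n: "n = 2 * m" by (elim evenE)
    define P where "P = (\<Prod>k=1..m. 4 * real k ^ 2 / (4 * real k ^ 2 - 1))"
    have IH: "central_prob n ^ 2 * (2 * real m + 1) * P = 1"
      using Suc.IH by (simp add: n P_def)
    have step: "central_prob (Suc n) ^ 2 * (2 * real (Suc m) + 1) * (P * (4 * real (Suc m) ^ 2 / (4 * real (Suc m) ^ 2 - 1)))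
       = central_prob n ^ 2 * (2 * real m + 1) * P"
    proof -
      define x where "x = real m"
      have x: "x \<ge> 0" by (simp add: x_def)
      have e: "4 * (1 + x) ^ 2 - 1 = (2 * x + 1) * (2 * x + 3)" by (simp add: power2_eq_square algebra_simps)
      show ?thesis
        unfolding central_prob_Suc_even[OF True] unfolding n of_nat_mult of_nat_numeral of_nat_Suc x_def[symmetric] e
        using x by (simp add: divide_simps) algebra
    qed
    have prod: "(\<Prod>k=1..Suc m. 4 * real k ^ 2 / (4 * real k ^ 2 - 1)) =
        P * (4 * real (Suc m) ^ 2 / (4 * real (Suc m) ^ 2 - 1))"
      unfolding P_def by (subst prod.cl_ivl_Suc) (simp only: not_less_eq less_one not_less_zero if_False le_eq_less_or_eq One_nat_def, simp)
    have half: "Suc (Suc n) div 2 = Suc m" by (simp add: n)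
    show ?thesis unfolding half prod by (rule trans[OF step IH])
  next
    case False
    then obtain m where n: "n = 2 * m + 1" by (elim oddE)
    have "Suc (Suc n) div 2 = Suc n div 2" by (simp add: n)
    then show ?thesis using Suc.IH unfolding central_prob_Suc_odd[OF False] by (simp only:)
  qed
qed

lemma central_prob_asymp: "(\<lambda>n. central_prob n * sqrt (real n)) \<longlonglongrightarrow> sqrt (2 / pi)"
proof -
  define P where "P n = (\<Prod>k=1..Suc n div 2. 4 * real k ^ 2 / (4 * real k ^ 2 - 1))" for n
  have "filterlim (\<lambda>n. Suc n div 2) at_top sequentially"
    unfolding filterlim_at_top
  proof
    fix Z show "\<forall>\<^sub>F n in sequentially. Z \<le> Suc n div 2"
      using eventually_ge_at_top[of "2 * Z"] by eventually_elim simp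
  qed
  from filterlim_compose[OF wallis this] have P: "P \<longlonglongrightarrow> pi / 2"
    by (simp add: P_def[abs_def])
  have "(\<lambda>n. real n / (2 * real (Suc n div 2) + 1)) \<longlonglongrightarrow> 1"
  proof (rule tendsto_sandwich)
    have two_halves: "n \<le> 2 * (Suc n div 2) \<and> 2 * (Suc n div 2) \<le> n + 1" for n :: nat by presburger
    have le: "real n \<le> 2 * real (Suc n div 2)" "2 * real (Suc n div 2) \<le> real n + 1" for n
      using two_halves[of n, folded of_nat_le_iff[where 'a = real]] by simp_all
    show "\<forall>\<^sub>F n in sequentially. real n / (real n + 2) \<le> real n / (2 * real (Suc n div 2) + 1)"
      using le by (intro always_eventually allI divide_left_mono) (auto simp: add_pos_nonneg)
    show "\<forall>\<^sub>F n in sequentially. real n / (2 * real (Suc n div 2) + 1) \<le> real n / (real n + 1)"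
      using le by (intro always_eventually allI divide_left_mono) (auto simp: add_pos_nonneg)
  qed real_asymp+
  then have "(\<lambda>n. sqrt (real n / (2 * real (Suc n div 2) + 1) / P n)) \<longlonglongrightarrow> sqrt (1 / (pi / 2))"
    by (intro tendsto_intros P) simp_all
  moreover have "sqrt (real n / (2 * real (Suc n div 2) + 1) / P n) = central_prob n * sqrt (real n)" for n
  proof -
    define d where "d = 2 * real (Suc n div 2) + 1"
    have w: "central_prob n ^ 2 * d * P n = 1"
      using central_prob_wallis[of n] unfolding d_def P_def .
    then have "d \<noteq> 0" "P n \<noteq> 0" by auto
    with w have "real n / d / P n = central_prob n ^ 2 * real n" by (simp add: field_simps)
    moreover have "central_prob n \<ge> 0" by (simp add: central_prob_def)
    ultimately show ?thesis by (simp add: d_def real_sqrt_mult)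
  qed
  ultimately show ?thesis by simp
qed

lemma bessel_pos: "bessel w > 0" "bessel w \<noteq> 0"
  using bessel_ge_1[of w] by auto

text \<open>One step of the chain takes \<open>r\<close> to \<open>r + 1 / r\<close>, \<open>r ^ 2\<close> to \<open>r ^ 2 + 3\<close> and \<open>r ^ 3\<close> to
\<open>r ^ 3 + 6 r + 1 / r\<close> on average, and the mean of \<open>1 / r\<close> is \<open>central_prob\<close>; the closed forms of the
first three moments are the sums of these increments.\<close>

lemma avg_bessel_1: "avg n bessel = (2 * real n + 1 + parity n) * central_prob n"
proof (induction n)
  case 0
  then show ?case by (simp add: parity_def central_prob_def bessel_def)
next
  case (Suc n)
  have "((r + 1) * (r + 1) + (r - 1) * (r - 1)) / (2 * r) = r + 1 / r" if "r \<noteq> 0" for r :: real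
    using that by (simp add: divide_simps) algebra
  then have "avg (Suc n) bessel = avg n (\<lambda>w. bessel w + 1 / bessel w)"
    using avg_bessel_Suc[of n "\<lambda>r. r"] by (simp add: bessel_pos)
  also have "\<dots> = (2 * real n + 2 + parity n) * central_prob n"
    unfolding avg_add Suc.IH avg_inverse_bessel central_prob_def[symmetric] by (simp add: algebra_simps)
  also have "\<dots> = (2 * real (Suc n) + 1 + parity (Suc n)) * central_prob (Suc n)"
    by (cases "even n") (simp_all add: parity_def central_prob_Suc_odd central_prob_Suc_even divide_simps algebra_simps)
  finally show ?case .
qed

lemma avg_bessel_2: "avg n (\<lambda>w. bessel w ^ 2) = 3 * real n + 1"
proof (induction n)
  case 0
  then show ?case by (simp add: bessel_def)
next
  case (Suc n)
  have "((r + 1) * (r + 1) ^ 2 + (r - 1) * (r - 1) ^ 2) / (2 * r) = r ^ 2 + 3" if "r \<noteq> 0" for r :: real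
    using that by (simp add: divide_simps) algebra
  then have "avg (Suc n) (\<lambda>w. bessel w ^ 2) = avg n (\<lambda>w. bessel w ^ 2 + 3)"
    using avg_bessel_Suc[of n "\<lambda>r. r ^ 2"] by (simp add: bessel_pos)
  then show ?case by (simp add: avg_add Suc.IH)
qed

lemma avg_bessel_3:
  "avg n (\<lambda>w. bessel w ^ 3) = (8 * real n ^ 2 + 4 * real n + 1 + parity n * (4 * real n - 1)) * central_prob n"
proof (induction n)
  case 0
  then show ?case by (simp add: parity_def central_prob_def bessel_def)
next
  case (Suc n)
  have "((r + 1) * (r + 1) ^ 3 + (r - 1) * (r - 1) ^ 3) / (2 * r) = r ^ 3 + 6 * r + 1 / r" if "r \<noteq> 0" for r :: real
    using that by (simp add: divide_simps) algebra
  then have "avg (Suc n) (\<lambda>w. bessel w ^ 3) = avg n (\<lambda>w. bessel w ^ 3 + 6 * bessel w + 1 / bessel w)"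
    using avg_bessel_Suc[of n "\<lambda>r. r ^ 3"] by (simp add: bessel_pos)
  also have "\<dots> = (8 * real n ^ 2 + 4 * real n + 1 + parity n * (4 * real n - 1)
       + 6 * (2 * real n + 1 + parity n) + 1) * central_prob n"
    unfolding avg_add avg_cmult Suc.IH avg_bessel_1 avg_inverse_bessel central_prob_def[symmetric]
    by (simp add: algebra_simps)
  also have "\<dots> = (8 * real (Suc n) ^ 2 + 4 * real (Suc n) + 1 + parity (Suc n) * (4 * real (Suc n) - 1)) * central_prob (Suc n)"
  proof (cases "even n")
    case True
    define x where "x = real n"
    have "x + 2 \<noteq> 0" by (simp add: x_def)
    then have "(8 * x ^ 2 + 16 * x + 8) * c = (8 * (x + 1) ^ 2 + 8 * (x + 1)) * (c * (x + 1) / (x + 2))" for c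
      by (simp add: divide_simps) algebra
    moreover have "8 * real n ^ 2 + 4 * real n + 1 + parity n * (4 * real n - 1)
        + 6 * (2 * real n + 1 + parity n) + 1 = 8 * x ^ 2 + 16 * x + 8"
      using True by (simp add: parity_def x_def)
    moreover have "8 * real (Suc n) ^ 2 + 4 * real (Suc n) + 1 + parity (Suc n) * (4 * real (Suc n) - 1)
        = 8 * (x + 1) ^ 2 + 8 * (x + 1)"
      using True by (simp add: parity_def x_def algebra_simps)
    ultimately show ?thesis
      unfolding central_prob_Suc_even[OF True] by (simp only: x_def)
  next
    case False
    then show ?thesis
      by (simp add: parity_def central_prob_Suc_odd power2_eq_square algebra_simps)
  qed
  finally show ?case .
qed

text \<open>After division by \<open>n powr (k / 2)\<close> the moments approach those of the Maxwell law, the law of the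
norm of a standard normal vector in three dimensions: \<open>2 * sqrt (2 / pi)\<close>, \<open>3\<close> and
\<open>8 * sqrt (2 / pi)\<close>.\<close>

lemma avg_bessel_1_asymp: "(\<lambda>n. avg n bessel / sqrt (real n)) \<longlonglongrightarrow> 2 * sqrt (2 / pi)"
proof -
  have "(\<lambda>n. (2 * real n + 1 + parity n) / real n) \<longlonglongrightarrow> 2"
  proof (rule tendsto_sandwich)
    show "\<forall>\<^sub>F n in sequentially. (2 * real n + 1) / real n \<le> (2 * real n + 1 + parity n) / real n"
      by (intro always_eventually allI divide_right_mono) (auto simp: parity_def)
    show "\<forall>\<^sub>F n in sequentially. (2 * real n + 1 + parity n) / real n \<le> (2 * real n + 2) / real n"
      by (intro always_eventually allI divide_right_mono) (auto simp: parity_def)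
  qed real_asymp+
  from tendsto_mult[OF this central_prob_asymp] show ?thesis
  proof (rule Lim_transform_eventually)
    show "\<forall>\<^sub>F n in sequentially. (2 * real n + 1 + parity n) / real n * (central_prob n * sqrt (real n)) =
        avg n bessel / sqrt (real n)"
      unfolding avg_bessel_1 by (intro always_eventually allI) (simp add: real_div_sqrt divide_simps)
  qed
qed

lemma avg_bessel_3_asymp: "(\<lambda>n. avg n (\<lambda>w. bessel w ^ 3) / sqrt (real n) ^ 3) \<longlonglongrightarrow> 8 * sqrt (2 / pi)"
proof -
  have "(\<lambda>n. (8 * real n ^ 2 + 4 * real n + 1 + parity n * (4 * real n - 1)) / real n ^ 2) \<longlonglongrightarrow> 8"
  proof (rule tendsto_sandwich)
    show "\<forall>\<^sub>F n in sequentially. (8 * real n ^ 2) / real n ^ 2 \<le>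
        (8 * real n ^ 2 + 4 * real n + 1 + parity n * (4 * real n - 1)) / real n ^ 2"
      by (intro always_eventually allI divide_right_mono) (auto simp: parity_def)
    show "\<forall>\<^sub>F n in sequentially. (8 * real n ^ 2 + 4 * real n + 1 + parity n * (4 * real n - 1)) / real n ^ 2
        \<le> (8 * real n ^ 2 + 8 * real n + 1) / real n ^ 2"
      by (intro always_eventually allI divide_right_mono) (auto simp: parity_def)
  qed real_asymp+
  from tendsto_mult[OF this central_prob_asymp] show ?thesis
  proof (rule Lim_transform_eventually)
    show "\<forall>\<^sub>F n in sequentially. (8 * real n ^ 2 + 4 * real n + 1 + parity n * (4 * real n - 1)) / real n ^ 2 *
       (central_prob n * sqrt (real n)) = avg n (\<lambda>w. bessel w ^ 3) / sqrt (real n) ^ 3"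
      using eventually_gt_at_top[of 0]
    proof eventually_elim
      case (elim n)
      then have "sqrt (real n) ^ 3 * sqrt (real n) = real n ^ 2"
        by (simp add: eval_nat_numeral flip: real_sqrt_mult)
      with elim show ?case unfolding avg_bessel_3 by (simp add: divide_simps mult.commute)
    qed
  qed
qed

section \<open>Sequences with a halving recurrence\<close>

lemma half_contraction_tendsto_0:
  fixes z e :: "nat \<Rightarrow> real"
  assumes "\<forall>\<^sub>F n in sequentially. z (Suc n) \<le> z n / 2 + e n" "\<And>n. z n \<ge> 0" "e \<longlonglongrightarrow> 0"
  shows "z \<longlonglongrightarrow> 0"
proof (rule LIMSEQ_I)
  fix r :: real assume "r > 0"
  then have "\<forall>\<^sub>F n in sequentially. e n < r / 4" by (intro order_tendstoD[OF assms(3)]) simp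
  with assms(1) have "\<forall>\<^sub>F n in sequentially. z (Suc n) \<le> z n / 2 + r / 4"
    by eventually_elim simp
  then obtain M where M: "z (Suc n) \<le> z n / 2 + r / 4" if "n \<ge> M" for n
    by (auto simp: eventually_at_top_linorder)
  have bound: "z (M + k) \<le> z M / 2 ^ k + r / 2" for k
  proof (induction k)
    case (Suc k)
    then show ?case using M[of "M + k"] by simp
  qed (use \<open>r > 0\<close> in simp)
  have "(\<lambda>k. z M / 2 ^ k) \<longlonglongrightarrow> 0" by real_asymp
  then have "\<forall>\<^sub>F k in sequentially. z M / 2 ^ k < r / 2"
    using \<open>r > 0\<close> by (intro order_tendstoD(2)[where y = 0]) simp_all
  then obtain K where K: "z M / 2 ^ k < r / 2" if "k \<ge> K" for k
    by (auto simp: eventually_at_top_linorder)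
  have "norm (z n - 0) < r" if "n \<ge> M + K" for n
  proof -
    have "z M / 2 ^ (n - M) < r / 2" using that by (intro K) simp
    moreover have "z n \<le> z M / 2 ^ (n - M) + r / 2" using bound[of "n - M"] that by simp
    ultimately have "z n < r" by linarith
    then show ?thesis using assms(2)[of n] by simp
  qed
  then show "\<exists>no. \<forall>n\<ge>no. norm (z n - 0) < r" by blast
qed

text \<open>The length of the initial run is geometrically distributed, so a moment of the whole game is an
exponentially weighted average of moments after the break, and inherits their growth.\<close>

lemma half_recurrence_asymp:
  fixes a h :: "nat \<Rightarrow> real"
  assumes rec: "\<And>n. a (Suc n) = a n / 2 + h n"
    and h: "(\<lambda>n. h n / sqrt (real n) ^ k) \<longlonglongrightarrow> c / 2"
  shows "(\<lambda>n. a n / sqrt (real n) ^ k) \<longlonglongrightarrow> c"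
proof -
  define x where "x n = a n / sqrt (real n) ^ k" for n
  \<comment> \<open>The recurrence of \<open>x\<close> has the coefficient \<open>q n / 2 \<le> 1 / 2\<close>, so the error contracts; it can
    fail at \<open>n = 0\<close>, where \<open>x 0\<close> divides by zero.\<close>
  define q where "q n = (sqrt (real n) / sqrt (real n + 1)) ^ k" for n :: nat
  define y where "y n = h n / sqrt (real n) ^ k * q n" for n
  have q1: "0 \<le> q n" "q n \<le> 1" for n
    by (auto simp: q_def divide_le_eq_1 intro!: power_le_one)
  have "(\<lambda>n. sqrt (real n) / sqrt (real n + 1)) \<longlonglongrightarrow> 1" by real_asymp
  from tendsto_power[OF this, of k] have q: "q \<longlonglongrightarrow> 1" by (simp add: q_def[abs_def])
  have step: "x (Suc n) - c = q n / 2 * (x n - c) + (c * q n / 2 + y n - c)" if "n > 0" for n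
  proof -
    have "x (Suc n) = q n / 2 * x n + y n"
      using that by (simp add: x_def y_def q_def rec field_simps power_divide)
    then show ?thesis by (simp add: field_simps)
  qed
  have "(\<lambda>n. \<bar>x n - c\<bar>) \<longlonglongrightarrow> 0"
  proof (rule half_contraction_tendsto_0)
    show "\<forall>\<^sub>F n in sequentially. \<bar>x (Suc n) - c\<bar> \<le> \<bar>x n - c\<bar> / 2 + \<bar>c * q n / 2 + y n - c\<bar>"
      using eventually_gt_at_top[of 0]
    proof eventually_elim
      case (elim n)
      have "\<bar>q n / 2 * (x n - c)\<bar> \<le> \<bar>x n - c\<bar> / 2"
        using q1[of n] by (simp add: abs_mult mult_left_le_one_le)
      then show ?case unfolding step[OF elim] by linarith
    qed
    have "(\<lambda>n. \<bar>c * q n / 2 + y n - c\<bar>) \<longlonglongrightarrow> \<bar>c * 1 / 2 + c / 2 * 1 - c\<bar>"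
      using tendsto_mult[OF h q] by (intro tendsto_intros q) (simp_all add: y_def[abs_def])
    then show "(\<lambda>n. \<bar>c * q n / 2 + y n - c\<bar>) \<longlonglongrightarrow> 0" by simp
  qed simp
  then have "(\<lambda>n. x n - c) \<longlonglongrightarrow> 0" by (simp add: tendsto_rabs_zero_iff)
  then show ?thesis unfolding x_def by (simp add: LIM_zero_iff)
qed

text \<open>The third cumulant of the limit vanishes exactly if \<open>pi = 16 / 5\<close> and its variance exactly if
\<open>pi = 8 / 3\<close>.  Taylor polynomials give \<open>cos (8 / 5) < 0 < cos (4 / 3)\<close>, which separates \<open>pi / 2\<close>
from both halves.\<close>

lemma pi_bounds: "8 / 3 < pi" "pi < 16 / 5"
proof -
  have cos_coeffs: "(\<Sum>m<4. cos_coeff m * x ^ m) = 1 - x ^ 2 / 2"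
    "(\<Sum>m<6. cos_coeff m * x ^ m) = 1 - x ^ 2 / 2 + x ^ 4 / 24" for x :: real
  proof -
    have "cos_coeff 0 = 1" "cos_coeff 1 = 0" "cos_coeff 2 = - 1 / 2" "cos_coeff 3 = 0"
      "cos_coeff 4 = 1 / 24" "cos_coeff 5 = 0"
      by (simp_all add: cos_coeff_def fact_numeral)
    moreover have "{..<4 :: nat} = {0, 1, 2, 3}" "{..<6 :: nat} = {0, 1, 2, 3, 4, 5}" by auto
    ultimately show "(\<Sum>m<4. cos_coeff m * x ^ m) = 1 - x ^ 2 / 2"
      "(\<Sum>m<6. cos_coeff m * x ^ m) = 1 - x ^ 2 / 2 + x ^ 4 / 24" by simp_all
  qed
  obtain t where t: "cos (8/5 :: real) = (\<Sum>m<4. cos_coeff m * (8/5) ^ m) + (cos (t + 1/2 * real 4 * pi) / fact 4) * (8/5) ^ 4"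
    using Maclaurin_cos_expansion[of "8/5" 4] by blast
  have "cos (t + 1/2 * real 4 * pi) \<le> 1" by simp
  then have "(cos (t + 1/2 * real 4 * pi) / fact 4) * (8/5) ^ 4 \<le> (1 / 24) * (8/5 :: real) ^ 4"
    by (intro mult_right_mono) (simp_all add: fact_numeral)
  then have "cos (8/5 :: real) < 0"
    unfolding t cos_coeffs by (simp add: power_divide)
  then have "\<not> (8/5 :: real) \<le> pi / 2"
    using cos_ge_zero[of "8/5"] pi_ge_two by auto
  then show "pi < 16 / 5" by simp
  obtain t where t: "cos (4/3 :: real) = (\<Sum>m<6. cos_coeff m * (4/3) ^ m) + (cos (t + 1/2 * real 6 * pi) / fact 6) * (4/3) ^ 6"
    using Maclaurin_cos_expansion[of "4/3" 6] by blast
  have "- 1 \<le> cos (t + 1/2 * real 6 * pi)" by (rule cos_ge_minus_one)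
  then have "(- 1 / 720) * (4/3) ^ 6 \<le> (cos (t + 1/2 * real 6 * pi) / fact 6) * (4/3 :: real) ^ 6"
    by (intro mult_right_mono) (simp_all add: fact_numeral)
  then have pos: "cos (4/3 :: real) > 0"
    unfolding t cos_coeffs by (simp add: power_divide)
  have "\<not> pi / 2 \<le> (4/3 :: real)"
  proof
    assume "pi / 2 \<le> (4/3 :: real)"
    then have "cos (4/3 :: real) \<le> cos (pi / 2)"
      using pi_ge_two by (intro cos_monotone_0_pi_le) auto
    with pos show False by simp
  qed
  then show "8 / 3 < pi" by simp
qed

section \<open>Moments of the number of correct guesses\<close>

text \<open>The affine normalisation for which the first letter of a word acts simply: a card of the initial
run adds \<open>1\<close>, and what follows the card that breaks the run is a
Bessel chain.\<close>

definition shifted_hits :: "bool list \<Rightarrow> real" where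
  "shifted_hits w = 2 * real (hits w) - real (length w) + 2"

lemma shifted_hits_False: "shifted_hits (False # w) = shifted_hits w + 1"
  by (simp add: shifted_hits_def)

lemma shifted_hits_True:
  "shifted_hits (True # w) = (if False \<in> set w then bessel w else real (length w) + 3)"
  by (simp add: shifted_hits_def bessel_def excess_def)

lemma bessel_all_True: "False \<notin> set w \<Longrightarrow> bessel w = real (length w) + 1"
proof -
  assume "False \<notin> set w"
  then have "majority_hits w = length w"
  proof (induction w)
    case (Cons x w)
    then have "x" "count_list w False = 0" by (auto simp: count_list_0_iff)
    with Cons show ?case by simp
  qed simp
  then show ?thesis by (simp add: bessel_def excess_def)
qed

lemma avg_all_True: "avg n (\<lambda>w. if False \<in> set w then 0 else c) = c / 2 ^ n"
  by (induction n) (simp_all add: avg_Suc)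

text \<open>The only word after the first \<open>True\<close> that does not follow the Bessel chain is the constant one,
which belongs to the unshuffled deck.\<close>

lemma avg_shifted_hits_True:
  "avg n (\<lambda>w. g (shifted_hits (True # w))) =
     avg n (\<lambda>w. g (bessel w)) + (g (real n + 3) - g (real n + 1)) / 2 ^ n"
proof -
  have "avg n (\<lambda>w. g (shifted_hits (True # w))) =
      avg n (\<lambda>w. g (bessel w) + (if False \<in> set w then 0 else g (real n + 3) - g (real n + 1)))"
    by (rule avg_cong) (auto simp: shifted_hits_True bessel_all_True words_def)
  then show ?thesis by (simp add: avg_add avg_all_True)
qed

text \<open>After the break at least half of the guesses succeed, whatever the deck.\<close>

lemma shifted_hits_nonneg: "shifted_hits w \<ge> 0"
proof (induction w)
  case (Cons x w)
  show ?case
  proof (cases x)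
    case True
    then show ?thesis using bessel_ge_1[of w] by (simp add: shifted_hits_True)
  qed (use Cons in \<open>simp add: shifted_hits_False\<close>)
qed (simp add: shifted_hits_def)

definition moment :: "nat \<Rightarrow> nat \<Rightarrow> real" where
  "moment k n = avg n (\<lambda>w. shifted_hits w ^ k)"

lemma moment_Suc:
  "moment k (Suc n) = (avg n (\<lambda>w. (shifted_hits w + 1) ^ k) +
     (avg n (\<lambda>w. bessel w ^ k) + ((real n + 3) ^ k - (real n + 1) ^ k) / 2 ^ n)) / 2"
  unfolding moment_def avg_Suc avg_shifted_hits_True[where g = "\<lambda>x. x ^ k"] shifted_hits_False ..

lemma moment_1_asymp: "(\<lambda>n. moment 1 n / sqrt (real n) ^ 1) \<longlonglongrightarrow> 2 * sqrt (2 / pi)"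
proof (rule half_recurrence_asymp)
  show "moment 1 (Suc n) = moment 1 n / 2 + (avg n bessel + (1 + 2 / 2 ^ n)) / 2" for n
    unfolding moment_Suc by (simp add: moment_def avg_add)
  have "(\<lambda>n. (1 + 2 / 2 ^ n) / sqrt (real n)) \<longlonglongrightarrow> 0" by real_asymp
  then have "(\<lambda>n. (avg n bessel / sqrt (real n) + (1 + 2 / 2 ^ n) / sqrt (real n)) / 2) \<longlonglongrightarrow>
      (2 * sqrt (2 / pi) + 0) / 2"
    by (intro tendsto_intros avg_bessel_1_asymp) simp_all
  then show "(\<lambda>n. (avg n bessel + (1 + 2 / 2 ^ n)) / 2 / sqrt (real n) ^ 1) \<longlonglongrightarrow> 2 * sqrt (2 / pi) / 2"
    by (simp add: add_divide_distrib mult.commute)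
qed

lemma moment_2_asymp: "(\<lambda>n. moment 2 n / sqrt (real n) ^ 2) \<longlonglongrightarrow> 3"
proof (rule half_recurrence_asymp)
  define e where "e n = 3 * real n + 2 + ((real n + 3) ^ 2 - (real n + 1) ^ 2) / 2 ^ n" for n :: nat
  show "moment 2 (Suc n) = moment 2 n / 2 + (2 * moment 1 n + e n) / 2" for n
  proof -
    have "(x + 1) ^ 2 = x ^ 2 + 2 * x + 1" for x :: real by algebra
    then have "avg n (\<lambda>w. (shifted_hits w + 1) ^ 2) = moment 2 n + 2 * moment 1 n + 1"
      by (simp only: avg_add avg_cmult avg_const) (simp add: moment_def)
    then show ?thesis unfolding moment_Suc avg_bessel_2 e_def by (simp add: field_simps)
  qed
  have "(\<lambda>n. e n / sqrt (real n) ^ 2) \<longlonglongrightarrow> 3"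
    unfolding e_def by real_asymp
  moreover have "(\<lambda>n. 1 / sqrt (real n)) \<longlonglongrightarrow> 0" by real_asymp
  ultimately have "(\<lambda>n. (2 * (moment 1 n / sqrt (real n) ^ 1) * (1 / sqrt (real n)) +
      e n / sqrt (real n) ^ 2) / 2) \<longlonglongrightarrow> (2 * (2 * sqrt (2 / pi)) * 0 + 3) / 2"
    by (intro tendsto_divide tendsto_add tendsto_mult tendsto_const moment_1_asymp) simp_all
  then show "(\<lambda>n. (2 * moment 1 n + e n) / 2 / sqrt (real n) ^ 2) \<longlonglongrightarrow> 3 / 2"
    by (simp add: add_divide_distrib mult.commute)
qed

lemma moment_3_asymp: "(\<lambda>n. moment 3 n / sqrt (real n) ^ 3) \<longlonglongrightarrow> 8 * sqrt (2 / pi)"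
proof (rule half_recurrence_asymp)
  define e where "e n = 1 + ((real n + 3) ^ 3 - (real n + 1) ^ 3) / 2 ^ n" for n :: nat
  show "moment 3 (Suc n) = moment 3 n / 2 +
      (avg n (\<lambda>w. bessel w ^ 3) + 3 * moment 2 n + 3 * moment 1 n + e n) / 2" for n
  proof -
    have "(x + 1) ^ 3 = x ^ 3 + 3 * x ^ 2 + 3 * x + 1" for x :: real by algebra
    then have "avg n (\<lambda>w. (shifted_hits w + 1) ^ 3) = moment 3 n + 3 * moment 2 n + 3 * moment 1 n + 1"
      by (simp only: avg_add avg_cmult avg_const) (simp add: moment_def)
    then show ?thesis unfolding moment_Suc e_def by (simp add: field_simps)
  qed
  have "(\<lambda>n. (avg n (\<lambda>w. bessel w ^ 3) / sqrt (real n) ^ 3 +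
        3 * (moment 2 n / sqrt (real n) ^ 2) * (1 / sqrt (real n)) +
        3 * (moment 1 n / sqrt (real n) ^ 1) * (1 / sqrt (real n) ^ 2) + e n / sqrt (real n) ^ 3) / 2)
      \<longlonglongrightarrow> (8 * sqrt (2 / pi) + 3 * 3 * 0 + 3 * (2 * sqrt (2 / pi)) * 0 + 0) / 2"
    unfolding e_def
    by (intro tendsto_divide tendsto_add tendsto_mult tendsto_const moment_1_asymp moment_2_asymp
        avg_bessel_3_asymp) (real_asymp | simp)+
  then show "(\<lambda>n. (avg n (\<lambda>w. bessel w ^ 3) + 3 * moment 2 n + 3 * moment 1 n + e n) / 2
      / sqrt (real n) ^ 3) \<longlonglongrightarrow> 8 * sqrt (2 / pi) / 2"
    by (simp add: add_divide_distrib power3_eq_cube power2_eq_square mult_ac)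
qed

lemma hits_eq_shifted_hits: "w \<in> words n \<Longrightarrow> real (hits w) = (shifted_hits w + real n - 2) / 2"
  by (simp add: shifted_hits_def words_def)

lemma mean_X_eq: "mean_X n = (moment 1 n + real n - 2) / 2"
proof -
  have "mean_X n = avg n (\<lambda>w. real (hits w))"
    unfolding mean_X_def by (rule expectation_riffle)
  also have "\<dots> = avg n (\<lambda>w. (1/2) * shifted_hits w + (real n - 2) / 2)"
    by (rule avg_cong) (simp add: hits_eq_shifted_hits)
  finally show ?thesis unfolding avg_add avg_cmult avg_const by (simp add: moment_def)
qed

lemma central_moment_X_eq: "central_moment_X k n = avg n (\<lambda>w. (shifted_hits w - moment 1 n) ^ k) / 2 ^ k"
proof -
  have "central_moment_X k n = avg n (\<lambda>w. (real (hits w) - mean_X n) ^ k)"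
    unfolding central_moment_X_def by (rule expectation_riffle)
  also have "\<dots> = avg n (\<lambda>w. (1 / 2 ^ k) * (shifted_hits w - moment 1 n) ^ k)"
    unfolding power_one_over[symmetric] power_mult_distrib[symmetric]
    by (rule avg_cong) (simp add: hits_eq_shifted_hits mean_X_eq add_divide_distrib diff_divide_distrib)
  finally show ?thesis unfolding avg_cmult by simp
qed

lemma central_moment_2: "central_moment_X 2 n = (moment 2 n - moment 1 n ^ 2) / 4"
proof -
  define m where "m = moment 1 n"
  have "(x - m) ^ 2 = x ^ 2 + (- 2 * m) * x + m ^ 2" for x by algebra
  then have "avg n (\<lambda>w. (shifted_hits w - m) ^ 2) = moment 2 n - 2 * m * m + m ^ 2"
    by (simp only: avg_add avg_cmult avg_const) (simp add: moment_def m_def)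
  then show ?thesis by (simp add: central_moment_X_eq m_def power2_eq_square)
qed

lemma central_moment_3:
  "central_moment_X 3 n = (moment 3 n - 3 * moment 1 n * moment 2 n + 2 * moment 1 n ^ 3) / 8"
proof -
  define m where "m = moment 1 n"
  have "(x - m) ^ 3 = x ^ 3 + (- 3 * m) * x ^ 2 + (3 * m ^ 2) * x + - (m ^ 3)" for x by algebra
  then have "avg n (\<lambda>w. (shifted_hits w - m) ^ 3) = moment 3 n - 3 * m * moment 2 n + 3 * m ^ 2 * m - m ^ 3"
    by (simp only: avg_add avg_cmult avg_const) (simp add: moment_def m_def)
  then show ?thesis by (simp add: central_moment_X_eq m_def power3_eq_cube power2_eq_square)
qed

lemma central_moment_2_asymp:
  "(\<lambda>n. central_moment_X 2 n / sqrt (real n) ^ 2) \<longlonglongrightarrow> (3 - 8 / pi) / 4"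
proof -
  have "(\<lambda>n. (moment 2 n / sqrt (real n) ^ 2 - (moment 1 n / sqrt (real n) ^ 1) ^ 2) / 4)
      \<longlonglongrightarrow> (3 - (2 * sqrt (2 / pi)) ^ 2) / 4"
    by (intro tendsto_intros moment_1_asymp moment_2_asymp) simp
  then show ?thesis
    by (simp add: central_moment_2 power_divide diff_divide_distrib power_mult_distrib mult.commute)
qed

lemma central_moment_3_asymp:
  "(\<lambda>n. central_moment_X 3 n / sqrt (real n) ^ 3) \<longlonglongrightarrow> sqrt (2 / pi) * (32 / pi - 10) / 8"
proof -
  define s where "s = sqrt (2 / pi)"
  have "(\<lambda>n. (moment 3 n / sqrt (real n) ^ 3 -
        3 * (moment 1 n / sqrt (real n) ^ 1) * (moment 2 n / sqrt (real n) ^ 2) +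
        2 * (moment 1 n / sqrt (real n) ^ 1) ^ 3) / 8)
      \<longlonglongrightarrow> (8 * s - 3 * (2 * s) * 3 + 2 * (2 * s) ^ 3) / 8"
    unfolding s_def by (intro tendsto_intros moment_1_asymp moment_2_asymp moment_3_asymp) simp
  moreover have "(8 * s - 3 * (2 * s) * 3 + 2 * (2 * s) ^ 3) / 8 = s * (32 / pi - 10) / 8"
  proof -
    have "s ^ 2 = 2 / pi" by (simp add: s_def)
    moreover have "8 * s - 3 * (2 * s) * 3 + 2 * (2 * s) ^ 3 = s * (16 * s ^ 2 - 10)" by algebra
    ultimately show ?thesis by simp
  qed
  ultimately show ?thesis
    by (simp add: central_moment_3 power_divide diff_divide_distrib add_divide_distrib s_def[symmetric]
        power3_eq_cube power2_eq_square algebra_simps)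
qed

lemma variance_limit_pos: "(3 - 8 / pi) / 4 > 0"
  using pi_bounds(1) by (simp add: divide_simps)

lemma central_moment_2_nonneg: "central_moment_X 2 n \<ge> 0"
  unfolding central_moment_X_def by (intro integral_nonneg_AE) simp

section \<open>Skewness and the failure of asymptotic normality\<close>

lemma skewness_X_asymp:
  "skewness_X \<longlonglongrightarrow> sqrt (2 / pi) * (32 / pi - 10) / 8 / ((3 - 8 / pi) / 4) powr (3/2)"
proof -
  have "(\<lambda>n. central_moment_X 3 n / sqrt (real n) ^ 3 /
      (central_moment_X 2 n / sqrt (real n) ^ 2) powr (3/2))
      \<longlonglongrightarrow> sqrt (2 / pi) * (32 / pi - 10) / 8 / ((3 - 8 / pi) / 4) powr (3/2)"
    using variance_limit_pos
    by (intro tendsto_divide tendsto_powr tendsto_const central_moment_2_asymp central_moment_3_asymp) auto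
  then show ?thesis
  proof (rule Lim_transform_eventually)
    show "\<forall>\<^sub>F n in sequentially. central_moment_X 3 n / sqrt (real n) ^ 3 /
      (central_moment_X 2 n / sqrt (real n) ^ 2) powr (3/2) = skewness_X n"
      using eventually_gt_at_top[of 0]
    proof eventually_elim
      case (elim n)
      have "(sqrt (real n) ^ 2) powr (3/2) = sqrt (real n) ^ 3"
        using elim by (simp add: powr_half_sqrt[symmetric] powr_powr flip: powr_realpow)
      then have "(central_moment_X 2 n / sqrt (real n) ^ 2) powr (3/2) =
          central_moment_X 2 n powr (3/2) / sqrt (real n) ^ 3"
        by (subst powr_divide) (simp_all add: central_moment_2_nonneg)
      then show ?case using elim by (simp add: skewness_X_def)
    qed
  qed
qed

lemma skewness_limit_nonzero: "sqrt (2 / pi) * (32 / pi - 10) / 8 / ((3 - 8 / pi) / 4) powr (3/2) \<noteq> 0"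
  using pi_bounds variance_limit_pos by (simp add: divide_simps)

lemma std_normal_null:
  assumes "A \<in> sets borel"
  shows "measure std_normal_distribution A = 0 \<longleftrightarrow> emeasure lborel A = 0"
proof -
  interpret real_distribution std_normal_distribution by (rule real_dist_normal_dist)
  have "measure std_normal_distribution A = 0 \<longleftrightarrow> A \<in> null_sets std_normal_distribution"
    using assms by (simp add: null_sets_def emeasure_eq_measure)
  also have "\<dots> \<longleftrightarrow> (AE x in lborel. x \<notin> A)"
  proof -
    have "\<not> std_normal_density x \<le> 0" for x
      using normal_density_pos[of 1 0 x] by linarith
    then show ?thesis
      using assms by (subst null_sets_density_iff) (simp_all add: ennreal_eq_0_iff)
  qed
  also have "\<dots> \<longleftrightarrow> emeasure lborel A = 0"
    using assms by (subst AE_iff_null_sets[symmetric]) (auto simp: null_sets_def)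
  finally show ?thesis .
qed

lemma cdf_std_normal_pos: "cdf std_normal_distribution x > 0"
proof -
  have "emeasure lborel {x - 1..x} \<le> emeasure lborel {..x}"
    by (intro emeasure_mono) auto
  then have "emeasure lborel {..x} \<noteq> 0" by auto
  then have "measure std_normal_distribution {..x} \<noteq> 0" by (simp add: std_normal_null)
  then show ?thesis
    unfolding cdf_def using measure_nonneg[of std_normal_distribution "{..x}"] by linarith
qed

lemma isCont_cdf_std_normal: "isCont (cdf std_normal_distribution) x"
proof -
  interpret real_distribution std_normal_distribution by (rule real_dist_normal_dist)
  show ?thesis unfolding isCont_cdf by (simp add: std_normal_null)
qed

text \<open>Since \<open>shifted_hits\<close> is nonnegative, \<open>X\<close> never falls more than \<open>moment 1 n / 2\<close> below its mean.\<close>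

lemma cdf_standardized_law_X_0:
  assumes "moment 1 n / (2 * sqrt (central_moment_X 2 n)) < L"
  shows "cdf (standardized_law_X n) (- L) = 0"
proof -
  define \<sigma> where "\<sigma> = sqrt (central_moment_X 2 n)"
  define Z where "Z d = (X n d - mean_X n) / \<sigma>" for d
  have "- L < Z d" if "d \<in> set_pmf (riffle_pmf n)" for d
  proof -
    from riffle_support[OF that] obtain w where w: "w \<in> words n" "correct_guesses n d = hits w"
      by blast
    have "- (moment 1 n / 2) \<le> X n d - mean_X n"
      using shifted_hits_nonneg[of w] w by (simp add: hits_eq_shifted_hits mean_X_eq field_simps)
    then have "- (moment 1 n / 2) / \<sigma> \<le> Z d"
      unfolding Z_def by (intro divide_right_mono) (simp_all add: \<sigma>_def central_moment_2_nonneg)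
    then show ?thesis using assms by (simp add: \<sigma>_def)
  qed
  then have "set_pmf (riffle_pmf n) \<inter> (Z -` {..- L}) = {}" by force
  then have "measure (measure_pmf (riffle_pmf n)) (Z -` {..- L}) = 0"
    by (simp add: measure_pmf_zero_iff)
  moreover have "standardized_law_X n = distr (measure_pmf (riffle_pmf n)) borel Z"
    unfolding standardized_law_X_def Z_def \<sigma>_def central_moment_X_def mean_X_def ..
  ultimately show ?thesis by (simp add: cdf_def measure_distr)
qed

text \<open>The bound of \<open>cdf_standardized_law_X_0\<close> on the left tail has a finite limit in units of the standard
deviation, because the mean of \<open>shifted_hits\<close> and the standard deviation both grow like \<open>sqrt n\<close>.  So the
standardized laws charge no mass far to the left, where the normal law does.\<close>

lemma not_asymptotically_normal: "\<not> weak_conv_m standardized_law_X std_normal_distribution"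
proof
  assume weak: "weak_conv_m standardized_law_X std_normal_distribution"
  define l where "l = 2 * sqrt (2 / pi) / (2 * sqrt ((3 - 8 / pi) / 4))"
  have "(\<lambda>n. (moment 1 n / sqrt (real n) ^ 1) / (2 * sqrt (central_moment_X 2 n / sqrt (real n) ^ 2))) \<longlonglongrightarrow> l"
    unfolding l_def using variance_limit_pos
    by (intro tendsto_intros moment_1_asymp central_moment_2_asymp) auto
  then have "\<forall>\<^sub>F n in sequentially.
      (moment 1 n / sqrt (real n) ^ 1) / (2 * sqrt (central_moment_X 2 n / sqrt (real n) ^ 2)) < l + 1"
    by (rule order_tendstoD(2)) simp
  then have "\<forall>\<^sub>F n in sequentially. cdf (standardized_law_X n) (- (l + 1)) = 0"
    using eventually_gt_at_top[of 0]
  proof eventually_elim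
    case (elim n)
    then have "moment 1 n / (2 * sqrt (central_moment_X 2 n)) < l + 1"
      by (simp add: real_sqrt_divide)
    then show ?case by (rule cdf_standardized_law_X_0)
  qed
  then have "(\<lambda>n. cdf (standardized_law_X n) (- (l + 1))) \<longlonglongrightarrow> 0"
    by (rule tendsto_eventually)
  moreover have "(\<lambda>n. cdf (standardized_law_X n) (- (l + 1))) \<longlonglongrightarrow> cdf std_normal_distribution (- (l + 1))"
    using weak isCont_cdf_std_normal by (simp add: weak_conv_m_def weak_conv_def)
  ultimately have "cdf std_normal_distribution (- (l + 1)) = 0"
    by (rule LIMSEQ_unique[symmetric])
  then show False using cdf_std_normal_pos[of "- (l + 1)"] by simp
qed

theorem mainTheorem4:
  shows "\<not> (skewness_X \<longlonglongrightarrow> 0) \<and>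
         \<not> weak_conv_m standardized_law_X std_normal_distribution"
  using LIMSEQ_unique[OF skewness_X_asymp] skewness_limit_nonzero not_asymptotically_normal by blast

end
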